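(* For every subset $A\subset\mathbb{N}_{\ge 2}$ there exists a countable, torsion-free group $G$ such that $gord^{*}(G)=gord(G)=A$.
   Context: For elements $g,x$ of a group $G$ put $g^x=xgx^{-1}$. A non-trivial element $g\in G$ is a generalized torsion element if there are $n\ge 1$ and $x_1,\dots,x_n\in G$ with $g^{x_1}\cdots g^{x_n}=1$; the minimum such $n$ is its generalized torsion order $gord(g)$. The generalized torsion order spectrum is $gord(G)=\{gord(g) : g\text{ is a generalized torsion element of }G\}$, and the strict generalized torsion order spectrum is $gord^{*}(G)=\{gord(g) : g\text{ is a generalized torsion element of }G\text{ that is not a torsion element}\}$. *)

theory Defs
  imports "HOL-Algebra.Group" "HOL-Library.Countable_Set"
begin

definition conjugate_by :: "('a, 'b) monoid_scheme \<Rightarrow> 'a \<Rightarrow> 'a \<Rightarrow> 'a"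
  where "conjugate_by G x g = x \<otimes>\<^bsub>G\<^esub> g \<otimes>\<^bsub>G\<^esub> inv\<^bsub>G\<^esub> x"

(* The group need not be commutative, so the product of the conjugates is taken along
   the list of conjugating elements, in order. *)
definition conjugate_product :: "('a, 'b) monoid_scheme \<Rightarrow> 'a \<Rightarrow> 'a list \<Rightarrow> 'a"
  where "conjugate_product G g xs =
    foldr (\<otimes>\<^bsub>G\<^esub>) (map (\<lambda>x. conjugate_by G x g) xs) \<one>\<^bsub>G\<^esub>"

definition trivial_conjugate_product :: "('a, 'b) monoid_scheme \<Rightarrow> 'a \<Rightarrow> nat \<Rightarrow> bool"
  where "trivial_conjugate_product G g n \<longleftrightarrow>
    n \<ge> 1 \<and> (\<exists>xs. length xs = n \<and> set xs \<subseteq> carrier G \<and> conjugate_product G g xs = \<one>\<^bsub>G\<^esub>)"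

definition generalized_torsion_element :: "('a, 'b) monoid_scheme \<Rightarrow> 'a \<Rightarrow> bool"
  where "generalized_torsion_element G g \<longleftrightarrow>
    g \<in> carrier G \<and> g \<noteq> \<one>\<^bsub>G\<^esub> \<and> (\<exists>n. trivial_conjugate_product G g n)"

(* Meaningful only if g is a generalized torsion element of G; otherwise LEAST is unspecified. *)
definition gord :: "('a, 'b) monoid_scheme \<Rightarrow> 'a \<Rightarrow> nat"
  where "gord G g = (LEAST n. trivial_conjugate_product G g n)"

(* The identity counts as a torsion element. *)
definition torsion_element :: "('a, 'b) monoid_scheme \<Rightarrow> 'a \<Rightarrow> bool"
  where "torsion_element G g \<longleftrightarrow>
    g \<in> carrier G \<and> (\<exists>n::nat. n \<ge> 1 \<and> g [^]\<^bsub>G\<^esub> n = \<one>\<^bsub>G\<^esub>)"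

definition torsion_free :: "('a, 'b) monoid_scheme \<Rightarrow> bool"
  where "torsion_free G \<longleftrightarrow> (\<forall>g. torsion_element G g \<longrightarrow> g = \<one>\<^bsub>G\<^esub>)"

definition gord_spectrum :: "('a, 'b) monoid_scheme \<Rightarrow> nat set"
  where "gord_spectrum G = {gord G g | g. generalized_torsion_element G g}"

definition strict_gord_spectrum :: "('a, 'b) monoid_scheme \<Rightarrow> nat set"
  where "strict_gord_spectrum G =
    {gord G g | g. generalized_torsion_element G g \<and> \<not> torsion_element G g}"

end

theory Submission
  imports Defs "HOL-Algebra.Product_Groups" "HOL-Algebra.Weak_Morphisms" "HOL-Number_Theory.Cong"
begin

text \<open>
  The abelian normal subgroup of a semidirect product turns generalized torsion into a question
  about sums. If \<open>\<Gamma>\<close> is an abelian group acting on \<open>\<rat>\<close> by multiplication with the values of a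
  character \<open>\<chi>\<close>, then a product of \<open>n\<close> conjugates of a non-zero \<open>m \<in> \<rat>\<close> in \<open>\<rat> \<rtimes> \<Gamma>\<close> is
  \<open>m\<close> times a sum of \<open>n\<close> values of \<open>\<chi>\<close>, and \<open>n\<close> conjugates of \<open>m\<close> can multiply to the
  identity exactly if some \<open>n\<close> values of \<open>\<chi>\<close> have sum \<open>0\<close>. An element outside \<open>\<rat>\<close> is not
  generalized torsion when \<open>\<Gamma>\<close> is torsion-free, since \<open>n\<close> of its
  conjugates have as product an element over \<open>\<gamma>\<^sup>n\<close>, where \<open>\<gamma> \<noteq> 1\<close> is its image in \<open>\<Gamma>\<close>.

  For \<open>k \<ge> 2\<close> the values of \<open>\<chi>\<close> are taken to be the rationals \<open>k\<^sup>i u / v\<close> (with \<open>i\<close> an integer)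
  where \<open>u \<equiv> v \<equiv> 1\<close> modulo \<open>k\<close>. A non-empty zero sum of such numbers, cleared of denominators and
  of the smallest power of \<open>k\<close> in it, shows modulo \<open>k\<close> that the number of terms with that smallest
  power is a multiple of \<open>k\<close>, so there are at least \<open>k\<close> terms (\<open>zero_sum_length\<close>). Conversely,
  every length \<open>n \<ge> k\<close> occurs: \<open>k - 1\<close> ones, \<open>n - k\<close> copies of \<open>k\<close>, and the integer
  congruent to \<open>1\<close> that cancels them (\<open>zero_sum_list_properties\<close>). The resulting group
  \<open>G\<^sub>k\<close> is \<open>twisted_affine_group k\<close>; in it \<open>n\<close> conjugates of a generalized torsion element
  can multiply to the identity if and only if \<open>n \<ge> k\<close>.

  It matters that all \<open>n \<ge> k\<close> occur and not only the multiples of \<open>k\<close>. In the direct sum of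
  the groups \<open>G\<^sub>k\<close> over \<open>k \<in> A\<close> \<open>n\<close> conjugates of an element can multiply to the identity if and
  only if this holds in every component. With the conditions \<open>k \<le> n\<close> the least such \<open>n\<close> is
  the largest index in the (finite) support, which lies in \<open>A\<close>
  (\<open>gord_spectrum_sum_group\<close>); with the conditions \<open>k dvd n\<close> it would be a least common multiple, which
  may lie outside \<open>A\<close>. So the direct sum has spectrum \<open>A\<close>. It is countable, hence isomorphic
  to a group on natural numbers.
\<close>

section \<open>Zero sums of scalars that are powers of k times units congruent to 1\<close>

text \<open>
  The multiplicative group of all \<open>k\<^sup>i u / v\<close> with \<open>u \<equiv> v \<equiv> 1\<close> modulo \<open>k\<close>. The equation is kept
  free of division, and the integer exponent is split into two natural ones, so that inversion
  merely exchanges the two sides.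
\<close>

definition admissible_scalar :: "nat \<Rightarrow> rat \<Rightarrow> bool"
  where "admissible_scalar k q \<longleftrightarrow> (\<exists>i j u v. [u = 1] (mod int k) \<and> [v = 1] (mod int k) \<and>
    q * (of_nat k ^ j * of_int v) = of_nat k ^ i * of_int u)"

lemma cong1_mult: "[u = 1] (mod n) \<Longrightarrow> [v = 1] (mod n) \<Longrightarrow> [u * v = 1] (mod n)" for n :: int
  using cong_mult[of u 1 n v 1] by simp

lemma cong1_nonzero: "2 \<le> k \<Longrightarrow> [u = 1] (mod int k) \<Longrightarrow> u \<noteq> 0"
  by (auto simp: cong_def)

lemma admissible_scalar_nonzero: "2 \<le> k \<Longrightarrow> admissible_scalar k q \<Longrightarrow> q \<noteq> 0"
  by (auto simp: admissible_scalar_def dest: cong1_nonzero)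

lemma admissible_scalar_1: "admissible_scalar k 1"
  unfolding admissible_scalar_def by (rule exI[of _ 0], rule exI[of _ 0], rule exI[of _ 1], rule exI[of _ 1]) auto

lemma admissible_scalar_mult:
  assumes "admissible_scalar k q" "admissible_scalar k r"
  shows "admissible_scalar k (q * r)"
proof -
  obtain i j u v where 1: "[u = 1] (mod int k)" "[v = 1] (mod int k)"
    "q * (of_nat k ^ j * of_int v) = of_nat k ^ i * of_int u"
    using assms(1) unfolding admissible_scalar_def by blast
  obtain i' j' u' v' where 2: "[u' = 1] (mod int k)" "[v' = 1] (mod int k)"
    "r * (of_nat k ^ j' * of_int v') = of_nat k ^ i' * of_int u'"
    using assms(2) unfolding admissible_scalar_def by blast
  have "q * r * (of_nat k ^ (j + j') * of_int (v * v')) =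
      (q * (of_nat k ^ j * of_int v)) * (r * (of_nat k ^ j' * of_int v'))"
    by (simp add: power_add mult_ac)
  also have "\<dots> = of_nat k ^ (i + i') * of_int (u * u')"
    unfolding 1(3) 2(3) by (simp add: power_add mult_ac)
  finally show ?thesis
    unfolding admissible_scalar_def using cong1_mult[OF 1(1) 2(1)] cong1_mult[OF 1(2) 2(2)] by blast
qed

lemma admissible_scalar_inverse:
  assumes "2 \<le> k" "admissible_scalar k q"
  shows "admissible_scalar k (inverse q)"
proof -
  have "q \<noteq> 0" using assms admissible_scalar_nonzero by blast
  with assms(2) show ?thesis unfolding admissible_scalar_def
    by (metis (no_types, lifting) mult.assoc mult.left_neutral left_inverse)
qed

text \<open>
  The product of all denominators serves for every element of the list; because the factors added
  are again powers of \<open>k\<close> times integers congruent to \<open>1\<close>, the shape of the numerators survives.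
\<close>

lemma common_denominator:
  assumes "\<forall>q\<in>set qs. admissible_scalar k q" "2 \<le> k"
  shows "\<exists>D \<noteq> 0. \<forall>q\<in>set qs. \<exists>e w. [w = 1] (mod int k) \<and> q * D = of_nat k ^ e * of_int w"
proof -
  \<comment> \<open>The induction needs the denominator itself to be a power of \<open>k\<close> times an integer congruent to \<open>1\<close>.\<close>
  have "\<exists>d b. [b = 1] (mod int k) \<and>
    (\<forall>q\<in>set qs. \<exists>e w. [w = 1] (mod int k) \<and> q * (of_nat k ^ d * of_int b) = of_nat k ^ e * of_int w)"
    using assms(1)
  proof (induction qs)
    case Nil
    show ?case by (auto intro: exI[of _ 1])
  next
    case (Cons r qs)
    then obtain d b where b: "[b = 1] (mod int k)" and
      qs: "\<forall>q\<in>set qs. \<exists>e w. [w = 1] (mod int k) \<and> q * (of_nat k ^ d * of_int b) = of_nat k ^ e * of_int w"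
      by auto
    from Cons.prems obtain i j u v where r: "[u = 1] (mod int k)" "[v = 1] (mod int k)"
      "r * (of_nat k ^ j * of_int v) = of_nat k ^ i * of_int u"
      unfolding admissible_scalar_def by auto
    have "\<exists>e w. [w = 1] (mod int k) \<and>
        q * (of_nat k ^ (d + j) * of_int (b * v)) = of_nat k ^ e * of_int w"
      if "q \<in> set (r # qs)" for q
    proof (cases "q = r")
      case True
      have "r * (of_nat k ^ (d + j) * of_int (b * v)) =
          (r * (of_nat k ^ j * of_int v)) * (of_nat k ^ d * of_int b)"
        by (simp add: power_add mult_ac)
      also have "\<dots> = of_nat k ^ (i + d) * of_int (u * b)"
        unfolding r(3) by (simp add: power_add mult_ac)
      finally show ?thesis unfolding True using cong1_mult[OF r(1) b] by blast
    next
      case False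
      with that qs obtain e w where w: "[w = 1] (mod int k)"
        "q * (of_nat k ^ d * of_int b) = of_nat k ^ e * of_int w" by (metis set_ConsD)
      have "q * (of_nat k ^ (d + j) * of_int (b * v)) =
          (q * (of_nat k ^ d * of_int b)) * (of_nat k ^ j * of_int v)"
        by (simp add: power_add mult_ac)
      also have "\<dots> = of_nat k ^ (e + j) * of_int (w * v)"
        unfolding w(2) by (simp add: power_add mult_ac)
      finally show ?thesis using cong1_mult[OF w(1) r(2)] by blast
    qed
    with cong1_mult[OF b r(2)] show ?case
      by blast
  qed
  then obtain d b where b: "[b = 1] (mod int k)" and
    *: "\<forall>q\<in>set qs. \<exists>e w. [w = 1] (mod int k) \<and> q * (of_nat k ^ d * of_int b) = of_nat k ^ e * of_int w"
    by blast
  moreover have "(of_nat k :: rat) ^ d * of_int b \<noteq> 0"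
    using cong1_nonzero[OF assms(2) b] assms(2) by simp
  ultimately show ?thesis by blast
qed

text \<open>
  After division by the smallest power of \<open>k\<close> that occurs, a term is congruent to \<open>1\<close> modulo \<open>k\<close>
  if it carries that power and to \<open>0\<close> otherwise. Hence \<open>k\<close> divides the positive number of terms
  of the first kind.
\<close>

lemma zero_sum_length:
  assumes k: "2 \<le> k" and qs: "\<forall>q\<in>set qs. admissible_scalar k q" "qs \<noteq> []" and sum: "sum_list qs = 0"
  shows "k \<le> length qs"
proof -
  obtain D where "D \<noteq> 0" and
    "\<forall>q\<in>set qs. \<exists>e w. [w = 1] (mod int k) \<and> q * D = of_nat k ^ e * of_int w"
    using common_denominator[OF qs(1) k] by blast
  then obtain e w where w: "\<And>q. q \<in> set qs \<Longrightarrow> [w q = 1] (mod int k)"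
    and ew: "\<And>q. q \<in> set qs \<Longrightarrow> q * D = of_nat k ^ e q * of_int (w q)"
    by metis
  define m where "m = Min (e ` set qs)"
  have m: "m \<le> e q" if "q \<in> set qs" for q
    unfolding m_def using that by simp
  have "m \<in> e ` set qs"
    unfolding m_def using qs(2) by (intro Min_in) auto
  then have ne: "filter (\<lambda>q. e q = m) qs \<noteq> []"
    by (auto simp: filter_empty_conv)
  define c where "c q = int k ^ (e q - m) * w q" for q
  have "of_int (\<Sum>q\<leftarrow>qs. c q) * (of_nat k ^ m) = (\<Sum>q\<leftarrow>qs. q * D)"
  proof -
    have "q * D = of_int (c q) * of_nat k ^ m" if "q \<in> set qs" for q
    proof -
      have "(of_nat k :: rat) ^ e q = of_nat k ^ (e q - m) * of_nat k ^ m"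
        using m[OF that] by (simp flip: power_add)
      then show ?thesis
        unfolding ew[OF that] by (simp add: c_def mult_ac)
    qed
    then have "(\<Sum>q\<leftarrow>qs. q * D) = (\<Sum>q\<leftarrow>qs. of_int (c q) * of_nat k ^ m)"
      by (intro arg_cong[of _ _ sum_list] map_cong) auto
    also have "\<dots> = of_int (\<Sum>q\<leftarrow>qs. c q) * (of_nat k ^ m)"
      by (induction qs) (simp_all add: algebra_simps)
    finally show ?thesis ..
  qed
  also have "\<dots> = 0"
    using sum by (simp add: sum_list_mult_const)
  finally have c0: "(\<Sum>q\<leftarrow>qs. c q) = 0"
    using k by simp
  have "[(\<Sum>q\<leftarrow>rs. c q) = int (length (filter (\<lambda>q. e q = m) rs))] (mod int k)"
    if "set rs \<subseteq> set qs" for rs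
    using that
  proof (induction rs)
    case (Cons r rs)
    have "[c r = (if e r = m then 1 else 0)] (mod int k)"
    proof (cases "e r = m")
      case False
      then obtain d where "e r - m = Suc d"
        using m[of r] Cons.prems by (metis Suc_diff_Suc le_neq_implies_less list.set_intros(1) subsetD)
      then show ?thesis using False by (simp add: c_def cong_0_iff)
    qed (use w Cons.prems in \<open>simp add: c_def\<close>)
    from cong_add[OF this Cons.IH] Cons.prems show ?case
      by (simp add: split: if_splits)
  qed simp
  from this[of qs] c0 have "int k dvd int (length (filter (\<lambda>q. e q = m) qs))"
    by (simp add: cong_0_iff cong_sym_eq[of 0])
  with ne have "k \<le> length (filter (\<lambda>q. e q = m) qs)"
    by (auto dest!: dvd_imp_le)
  also have "\<dots> \<le> length qs"
    by simp
  finally show ?thesis .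
qed

text \<open>
  The first entry is congruent to \<open>1\<close> modulo \<open>k\<close> and cancels the others, whose sum is
  \<open>(n - k) k + (k - 1)\<close>.
\<close>

definition zero_sum_list :: "nat \<Rightarrow> nat \<Rightarrow> rat list" where
  "zero_sum_list k n = of_int (1 - int k * (1 + int (n - k))) #
     replicate (n - k) (of_nat k) @ replicate (k - 1) 1"

lemma zero_sum_list_properties:
  assumes "2 \<le> k" "k \<le> n"
  shows "length (zero_sum_list k n) = n" "sum_list (zero_sum_list k n) = 0"
    "\<forall>q\<in>set (zero_sum_list k n). admissible_scalar k q"
proof -
  have "admissible_scalar k (of_int (1 - int k * (1 + int (n - k))))"
    unfolding admissible_scalar_def
    by (rule exI[of _ 0], rule exI[of _ 0], rule exI[of _ "1 - int k * (1 + int (n - k))"], rule exI[of _ 1])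
       (simp add: cong_iff_dvd_diff)
  moreover have "admissible_scalar k (of_nat k)"
    unfolding admissible_scalar_def
    by (rule exI[of _ 1], rule exI[of _ 0], rule exI[of _ 1], rule exI[of _ 1]) simp
  ultimately show "\<forall>q\<in>set (zero_sum_list k n). admissible_scalar k q"
    by (auto simp: zero_sum_list_def admissible_scalar_1)
  show "length (zero_sum_list k n) = n" "sum_list (zero_sum_list k n) = 0"
    using assms by (auto simp: zero_sum_list_def sum_list_replicate algebra_simps of_nat_diff)
qed

section \<open>Products of conjugates under homomorphisms and isomorphisms\<close>

lemma conjugate_product_Nil [simp]: "conjugate_product G g [] = \<one>\<^bsub>G\<^esub>"
  by (simp add: conjugate_product_def)

lemma conjugate_product_Cons [simp]:
  "conjugate_product G g (x # xs) = conjugate_by G x g \<otimes>\<^bsub>G\<^esub> conjugate_product G g xs"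
  by (simp add: conjugate_product_def)

context group
begin

lemma conjugate_by_closed:
  "x \<in> carrier G \<Longrightarrow> g \<in> carrier G \<Longrightarrow> conjugate_by G x g \<in> carrier G"
  by (simp add: conjugate_by_def)

lemma conjugate_product_closed:
  "set xs \<subseteq> carrier G \<Longrightarrow> g \<in> carrier G \<Longrightarrow> conjugate_product G g xs \<in> carrier G"
  by (induction xs) (auto simp: conjugate_by_closed)

lemma conjugate_product_one:
  "set xs \<subseteq> carrier G \<Longrightarrow> conjugate_product G \<one> xs = \<one>"
  by (induction xs) (auto simp: conjugate_by_def)

lemma trivial_conjugate_product_one:
  "trivial_conjugate_product G \<one> n \<longleftrightarrow> 1 \<le> n"
proof -
  have "\<exists>xs. length xs = n \<and> set xs \<subseteq> carrier G"
    by (rule exI[of _ "replicate n \<one>"]) auto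
  then show ?thesis
    by (auto simp: trivial_conjugate_product_def conjugate_product_one)
qed

end

lemma hom_conjugate_product:
  assumes "group G" "group H" "h \<in> hom G H" "g \<in> carrier G" "set xs \<subseteq> carrier G"
  shows "conjugate_product H (h g) (map h xs) = h (conjugate_product G g xs)"
proof -
  interpret group_hom G H h
    using assms(1-3) by (simp add: group_hom_def group_hom_axioms_def)
  show ?thesis
    using assms(4,5)
    by (induction xs) (auto simp: conjugate_by_def G.conjugate_product_closed)
qed

lemma trivial_conjugate_product_iso:
  assumes "group G" "group H" "h \<in> iso G H" "g \<in> carrier G"
  shows "trivial_conjugate_product H (h g) n \<longleftrightarrow> trivial_conjugate_product G g n"
proof -
  interpret group_hom G H h
    using assms(1-3) by (simp add: group_hom_def group_hom_axioms_def iso_def)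
  have bij: "bij_betw h (carrier G) (carrier H)"
    using assms(3) by (simp add: iso_def)
  have *: "conjugate_product H (h g) (map h xs) = \<one>\<^bsub>H\<^esub> \<longleftrightarrow> conjugate_product G g xs = \<one>\<^bsub>G\<^esub>"
    if "set xs \<subseteq> carrier G" for xs
  proof -
    have "inj_on h (carrier G)"
      using bij by (rule bij_betw_imp_inj_on)
    then have "h (conjugate_product G g xs) = h \<one>\<^bsub>G\<^esub> \<longleftrightarrow> conjugate_product G g xs = \<one>\<^bsub>G\<^esub>"
      by (rule inj_on_eq_iff) (use that assms(4) in \<open>simp_all add: G.conjugate_product_closed\<close>)
    then show ?thesis
      by (simp add: hom_conjugate_product[OF assms(1,2) homh assms(4) that])
  qed
  have "(\<exists>ys. length ys = n \<and> set ys \<subseteq> carrier H \<and> conjugate_product H (h g) ys = \<one>\<^bsub>H\<^esub>) \<longleftrightarrow>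
      (\<exists>xs. length xs = n \<and> set xs \<subseteq> carrier G \<and> conjugate_product G g xs = \<one>\<^bsub>G\<^esub>)"
    (is "?L \<longleftrightarrow> ?R")
  proof
    assume ?L
    then obtain ys where ys: "length ys = n" "set ys \<subseteq> h ` carrier G"
      "conjugate_product H (h g) ys = \<one>\<^bsub>H\<^esub>"
      using bij by (auto simp: bij_betw_def)
    from ys(2) have "ys \<in> map h ` lists (carrier G)"
      by (simp only: lists_image[symmetric] in_lists_conv_set) blast
    then obtain xs where "set xs \<subseteq> carrier G" "ys = map h xs"
      by (auto simp: in_lists_conv_set)
    then show ?R
      using ys * by auto
  next
    assume ?R
    then obtain xs where "length xs = n" "set xs \<subseteq> carrier G" "conjugate_product G g xs = \<one>\<^bsub>G\<^esub>"
      by blast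
    then show ?L
      using * by (intro exI[of _ "map h xs"]) auto
  qed
  then show ?thesis
    by (simp add: trivial_conjugate_product_def)
qed

lemma gord_spectrum_iso:
  assumes "group G" "group H" "h \<in> iso G H"
  shows "gord_spectrum H = gord_spectrum G"
proof -
  have bij: "bij_betw h (carrier G) (carrier H)"
    using assms(3) by (simp add: iso_def)
  have one: "h g = \<one>\<^bsub>H\<^esub> \<longleftrightarrow> g = \<one>\<^bsub>G\<^esub>" if "g \<in> carrier G" for g
    using inj_on_eq_iff[OF bij_betw_imp_inj_on[OF bij] that group.is_monoid[OF assms(1), THEN monoid.one_closed]]
      hom_one[OF iso_imp_homomorphism[OF assms(3)] assms(1,2)] by simp
  have gord: "gord H (h g) = gord G g" if "g \<in> carrier G" for g
    using trivial_conjugate_product_iso[OF assms that] by (simp add: gord_def)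
  have gte: "generalized_torsion_element H (h g) \<longleftrightarrow> generalized_torsion_element G g"
    if "g \<in> carrier G" for g
    using trivial_conjugate_product_iso[OF assms that] that one[OF that] bij
    by (auto simp: generalized_torsion_element_def bij_betw_def)
  have "gord_spectrum H = gord H ` {y \<in> h ` carrier G. generalized_torsion_element H y}"
    using bij by (auto simp: gord_spectrum_def generalized_torsion_element_def bij_betw_def)
  also have "\<dots> = gord G ` {g \<in> carrier G. generalized_torsion_element G g}"
    using gord gte by (force simp: image_iff)
  also have "\<dots> = gord_spectrum G"
    by (auto simp: gord_spectrum_def generalized_torsion_element_def)
  finally show ?thesis .
qed

lemma torsion_free_iso:
  assumes "group G" "group H" "h \<in> iso G H" "torsion_free G"
  shows "torsion_free H"
  unfolding torsion_free_def
proof (intro allI impI)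
  interpret group_hom G H h
    using assms(1-3) by (simp add: group_hom_def group_hom_axioms_def iso_def)
  fix y assume "torsion_element H y"
  then obtain n :: nat where n: "1 \<le> n" "y [^]\<^bsub>H\<^esub> n = \<one>\<^bsub>H\<^esub>" and "y \<in> carrier H"
    by (auto simp: torsion_element_def)
  with assms(3) obtain g where g: "g \<in> carrier G" "y = h g"
    by (auto simp: iso_def bij_betw_def)
  then have "h (g [^]\<^bsub>G\<^esub> n) = h \<one>\<^bsub>G\<^esub>"
    using n(2) by (simp add: hom_nat_pow)
  then have "g [^]\<^bsub>G\<^esub> n = \<one>\<^bsub>G\<^esub>"
    using assms(3) g by (auto simp: iso_def bij_betw_def inj_on_def)
  then show "y = \<one>\<^bsub>H\<^esub>"
    using assms(4) n(1) g by (auto simp: torsion_free_def torsion_element_def)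
qed

text \<open>
  A generalized torsion element is non-trivial, so in a torsion-free group it is never torsion.
\<close>

lemma strict_gord_spectrum_torsion_free:
  "torsion_free G \<Longrightarrow> strict_gord_spectrum G = gord_spectrum G"
  by (auto simp: torsion_free_def strict_gord_spectrum_def gord_spectrum_def
      generalized_torsion_element_def)

lemma countable_group_iso_nat:
  assumes "group G" "countable (carrier G)"
  shows "\<exists>(H :: nat monoid) h. group H \<and> h \<in> iso G H"
proof -
  interpret group G by fact
  have "inj_on (to_nat_on (carrier G)) (carrier G)"
    using assms(2) by (rule inj_on_to_nat_on)
  then show ?thesis
    using inj_imp_image_group_is_group inj_imp_image_group_iso by blast
qed

section \<open>Generalized torsion in direct sums\<close>

lemma conjugate_product_sum_group:
  assumes "\<And>i. i \<in> I \<Longrightarrow> group (G i)" "set ys \<subseteq> carrier (sum_group I G)"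
  shows "conjugate_product (sum_group I G) x ys =
    (\<lambda>i\<in>I. conjugate_product (G i) (x i) (map (\<lambda>y. y i) ys))"
  using assms(2)
  by (induction ys) (auto simp: conjugate_by_def assms(1) intro!: restrict_ext)

text \<open>
  Conjugating elements may be chosen independently in each component. In the components where
  \<open>x\<close> is trivial they are chosen trivial, which keeps the support of every combined conjugating
  element inside the finite support of \<open>x\<close>.
\<close>

lemma trivial_conjugate_product_sum_group:
  assumes G: "\<And>i. i \<in> I \<Longrightarrow> group (G i)" and x: "x \<in> carrier (sum_group I G)"
  shows "trivial_conjugate_product (sum_group I G) x n \<longleftrightarrow>
    1 \<le> n \<and> (\<forall>i\<in>I. trivial_conjugate_product (G i) (x i) n)" (is "?L \<longleftrightarrow> ?R")
proof
  assume ?L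
  then obtain ys where ys: "1 \<le> n" "length ys = n" "set ys \<subseteq> carrier (sum_group I G)"
    "conjugate_product (sum_group I G) x ys = \<one>\<^bsub>sum_group I G\<^esub>"
    by (auto simp: trivial_conjugate_product_def)
  have "conjugate_product (G i) (x i) (map (\<lambda>y. y i) ys) = \<one>\<^bsub>G i\<^esub>" if "i \<in> I" for i
    using fun_cong[OF ys(4), of i] that by (simp add: conjugate_product_sum_group[OF G ys(3)])
  moreover have "set (map (\<lambda>y. y i) ys) \<subseteq> carrier (G i)" if "i \<in> I" for i
    using ys(3) that by (auto simp: carrier_sum_group[OF G])
  ultimately show ?R
    using ys(1,2) unfolding trivial_conjugate_product_def by (metis length_map)
next
  assume R: ?R
  have "\<exists>zs. length zs = n \<and> set zs \<subseteq> carrier (G i) \<and> conjugate_product (G i) (x i) zs = \<one>\<^bsub>G i\<^esub> \<and>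
      (x i = \<one>\<^bsub>G i\<^esub> \<longrightarrow> zs = replicate n \<one>\<^bsub>G i\<^esub>)" if "i \<in> I" for i
  proof (cases "x i = \<one>\<^bsub>G i\<^esub>")
    case True
    have *: "set (replicate n \<one>\<^bsub>G i\<^esub>) \<subseteq> carrier (G i)"
      using G[OF that] by (auto simp: group.is_monoid)
    then show ?thesis
      using group.conjugate_product_one[OF G[OF that] *] True
      by (intro exI[of _ "replicate n \<one>\<^bsub>G i\<^esub>"]) simp
  next
    case False
    then show ?thesis
      using R that by (auto simp: trivial_conjugate_product_def)
  qed
  then obtain zs where len: "\<And>i. i \<in> I \<Longrightarrow> length (zs i) = n"
    and zs: "\<And>i. i \<in> I \<Longrightarrow> set (zs i) \<subseteq> carrier (G i)"
    and prod: "\<And>i. i \<in> I \<Longrightarrow> conjugate_product (G i) (x i) (zs i) = \<one>\<^bsub>G i\<^esub>"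
    and rep: "\<And>i. i \<in> I \<Longrightarrow> x i = \<one>\<^bsub>G i\<^esub> \<Longrightarrow> zs i = replicate n \<one>\<^bsub>G i\<^esub>"
    by metis
  define ys where "ys = map (\<lambda>j. \<lambda>i\<in>I. zs i ! j) [0..<n]"
  have "(\<lambda>i\<in>I. zs i ! j) \<in> carrier (sum_group I G)" if "j < n" for j
  proof -
    have "{i \<in> I. zs i ! j \<noteq> \<one>\<^bsub>G i\<^esub>} \<subseteq> {i \<in> I. x i \<noteq> \<one>\<^bsub>G i\<^esub>}"
      using that rep by auto
    moreover have "finite {i \<in> I. x i \<noteq> \<one>\<^bsub>G i\<^esub>}"
      using x by (simp add: carrier_sum_group[OF G])
    ultimately have "finite {i \<in> I. zs i ! j \<noteq> \<one>\<^bsub>G i\<^esub>}"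
      by (rule finite_subset)
    moreover have "zs i ! j \<in> carrier (G i)" if "i \<in> I" for i
      using zs[OF that] len[OF that] \<open>j < n\<close> by (metis nth_mem subsetD)
    ultimately show ?thesis
      by (auto simp: carrier_sum_group[OF G] cong: conj_cong)
  qed
  then have ys: "set ys \<subseteq> carrier (sum_group I G)"
    by (auto simp: ys_def)
  have "map (\<lambda>y. y i) ys = zs i" if "i \<in> I" for i
    using that len[OF that] map_nth[of "zs i"] by (simp add: ys_def comp_def)
  then have "conjugate_product (sum_group I G) x ys = \<one>\<^bsub>sum_group I G\<^esub>"
    using prod by (auto simp: conjugate_product_sum_group[OF G ys] intro!: restrict_ext)
  with ys R show ?L
    unfolding trivial_conjugate_product_def by (metis length_map length_upt minus_nat.diff_0 ys_def)
qed

lemma torsion_free_sum_group: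
  assumes G: "\<And>i. i \<in> I \<Longrightarrow> group (G i)" and tf: "\<And>i. i \<in> I \<Longrightarrow> torsion_free (G i)"
  shows "torsion_free (sum_group I G)"
  unfolding torsion_free_def
proof (intro allI impI)
  interpret S: group "sum_group I G" using G by simp
  fix x assume "torsion_element (sum_group I G) x"
  then obtain n :: nat where n: "1 \<le> n" "x [^]\<^bsub>sum_group I G\<^esub> n = \<one>\<^bsub>sum_group I G\<^esub>"
    and x: "x \<in> carrier (sum_group I G)"
    by (auto simp: torsion_element_def)
  have "x i = \<one>\<^bsub>G i\<^esub>" if i: "i \<in> I" for i
  proof -
    interpret group "G i" using G i .
    have "(x [^]\<^bsub>sum_group I G\<^esub> m) i = x i [^]\<^bsub>G i\<^esub> m" for m :: nat
      using i by (induction m) simp_all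
    with n(2) i have "x i [^]\<^bsub>G i\<^esub> n = \<one>\<^bsub>G i\<^esub>"
      by (metis one_sum_group restrict_apply')
    moreover have "x i \<in> carrier (G i)"
      using x i by (auto simp: carrier_sum_group[OF G])
    ultimately show ?thesis
      using tf[OF i] n(1) by (auto simp: torsion_free_def torsion_element_def)
  qed
  with x show "x = \<one>\<^bsub>sum_group I G\<^esub>"
    by (auto simp: carrier_sum_group[OF G] PiE_iff extensional_def)
qed

text \<open>
  An element is determined by the graph of its restriction to its support, a finite subset of a
  countable set.
\<close>

lemma countable_sum_group:
  assumes G: "\<And>i. i \<in> I \<Longrightarrow> group (G i)"
    and "countable I" "\<And>i. i \<in> I \<Longrightarrow> countable (carrier (G i))"
  shows "countable (carrier (sum_group I G))"
proof -
  define graph where "graph x = (\<lambda>i. (i, x i)) ` {i \<in> I. x i \<noteq> \<one>\<^bsub>G i\<^esub>}" for x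
  have "graph ` carrier (sum_group I G) \<subseteq> Fpow (Sigma I (\<lambda>i. carrier (G i)))"
    by (auto simp: graph_def carrier_sum_group[OF G] Fpow_def)
  moreover have "countable (Fpow (Sigma I (\<lambda>i. carrier (G i))))"
    using assms by (intro countable_Fpow countable_SIGMA)
  ultimately have "countable (graph ` carrier (sum_group I G))"
    by (rule countable_subset)
  moreover have "inj_on graph (carrier (sum_group I G))"
  proof (rule inj_onI)
    fix x y assume xy: "x \<in> carrier (sum_group I G)" "y \<in> carrier (sum_group I G)" "graph x = graph y"
    have "x i = y i" if "i \<in> I" for i
    proof -
      have "(i, x i) \<in> graph x \<longleftrightarrow> (i, x i) \<in> graph y" "(i, y i) \<in> graph x \<longleftrightarrow> (i, y i) \<in> graph y"
        using xy(3) by simp_all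
      then show ?thesis
        using that by (auto simp: graph_def)
    qed
    with xy(1,2) show "x = y"
      by (auto simp: carrier_sum_group[OF G] intro: PiE_ext)
  qed
  ultimately show ?thesis
    by (rule countable_image_inj_on)
qed

text \<open>
  If \<open>n\<close> conjugates of a generalized torsion element of \<open>G k\<close> can multiply to the identity exactly
  when \<open>k \<le> n\<close>, then for an element of the direct sum the condition on \<open>n\<close> is that it bounds the
  support, so the order is the maximum of the support. The premise with \<open>n\<^sub>0\<close> restricts the
  threshold condition to generalized torsion elements.
\<close>

lemma gord_spectrum_sum_group:
  assumes G: "\<And>k. k \<in> A \<Longrightarrow> group (G k)" and A: "A \<subseteq> {1..}"
    and threshold: "\<And>k g n\<^sub>0 n. k \<in> A \<Longrightarrow> g \<in> carrier (G k) \<Longrightarrow> g \<noteq> \<one>\<^bsub>G k\<^esub> \<Longrightarrow>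
      trivial_conjugate_product (G k) g n\<^sub>0 \<Longrightarrow> trivial_conjugate_product (G k) g n \<longleftrightarrow> k \<le> n"
    and ex: "\<And>k. k \<in> A \<Longrightarrow> \<exists>g. generalized_torsion_element (G k) g"
  shows "gord_spectrum (sum_group A G) = A"
proof -
  define S where "S x = {k \<in> A. x k \<noteq> \<one>\<^bsub>G k\<^esub>}" for x
  have gord: "gord (sum_group A G) x = Max (S x) \<and> S x \<noteq> {} \<and> finite (S x)"
    if gte: "generalized_torsion_element (sum_group A G) x" for x
  proof -
    from gte obtain n\<^sub>0 where x: "x \<in> carrier (sum_group A G)" "x \<noteq> \<one>\<^bsub>sum_group A G\<^esub>"
      and "trivial_conjugate_product (sum_group A G) x n\<^sub>0"
      by (auto simp: generalized_torsion_element_def)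
    then have n\<^sub>0: "trivial_conjugate_product (G k) (x k) n\<^sub>0" if "k \<in> A" for k
      using that by (auto simp: trivial_conjugate_product_sum_group[OF G x(1)])
    have fin: "finite (S x)"
      using x by (simp add: S_def carrier_sum_group[OF G])
    have ne: "S x \<noteq> {}"
      using x by (auto simp: S_def carrier_sum_group[OF G] PiE_iff extensional_def)
    have "trivial_conjugate_product (G k) (x k) n \<longleftrightarrow> (k \<in> S x \<longrightarrow> k \<le> n)" if "1 \<le> n" "k \<in> A" for k n
    proof (cases "x k = \<one>\<^bsub>G k\<^esub>")
      case True
      then show ?thesis
        using group.trivial_conjugate_product_one[OF G[OF that(2)]] that(1) by (simp add: S_def)
    next
      case False
      moreover have "x k \<in> carrier (G k)"
        using x that by (auto simp: carrier_sum_group[OF G])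
      ultimately show ?thesis
        using threshold[OF that(2) _ _ n\<^sub>0[OF that(2)]] that by (simp add: S_def)
    qed
    then have "trivial_conjugate_product (sum_group A G) x n \<longleftrightarrow> 1 \<le> n \<and> (\<forall>k\<in>S x. k \<le> n)" for n
      by (auto simp: trivial_conjugate_product_sum_group[OF G x(1)] S_def)
    also have "1 \<le> n \<and> (\<forall>k\<in>S x. k \<le> n) \<longleftrightarrow> Max (S x) \<le> n" for n
    proof -
      have "1 \<le> Max (S x)"
        using Max_in[OF fin ne] A by (auto simp: S_def)
      then show ?thesis
        using fin ne by (metis Max_ge_iff Max_le_iff order.trans)
    qed
    finally have "gord (sum_group A G) x = Max (S x)"
      unfolding gord_def by (intro Least_equality) auto
    with fin ne show ?thesis by simp
  qed
  show ?thesis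
  proof (intro equalityI subsetI)
    fix n assume "n \<in> gord_spectrum (sum_group A G)"
    then obtain x where "n = Max (S x)" "S x \<noteq> {}" "finite (S x)"
      using gord by (auto simp: gord_spectrum_def)
    then have "n \<in> S x" by simp
    then show "n \<in> A" by (simp add: S_def)
  next
    fix k assume k: "k \<in> A"
    then obtain g n where g: "g \<in> carrier (G k)" "g \<noteq> \<one>\<^bsub>G k\<^esub>" "trivial_conjugate_product (G k) g n"
      using ex[OF k] unfolding generalized_torsion_element_def by blast
    define x where "x = (\<lambda>i\<in>A. if i = k then g else \<one>\<^bsub>G i\<^esub>)"
    have Sx: "S x = {k}"
      using k g(2) by (auto simp: S_def x_def)
    have "x i \<in> carrier (G i)" if "i \<in> A" for i
      using g(1) G[OF that] that by (auto simp: x_def group.is_monoid)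
    then have x: "x \<in> carrier (sum_group A G)"
      using Sx by (auto simp: carrier_sum_group[OF G] S_def PiE_iff x_def)
    have "x \<noteq> \<one>\<^bsub>sum_group A G\<^esub>"
      using k g(2) by (auto simp: x_def dest!: fun_cong[of _ _ k])
    moreover have "1 \<le> n"
      using g(3) by (simp add: trivial_conjugate_product_def)
    moreover have "trivial_conjugate_product (G i) (x i) n" if "i \<in> A" for i
      using that g(3) group.trivial_conjugate_product_one[OF G[OF that]] \<open>1 \<le> n\<close> by (auto simp: x_def)
    ultimately have "generalized_torsion_element (sum_group A G) x"
      using x by (auto simp: generalized_torsion_element_def trivial_conjugate_product_sum_group[OF G x])
    then show "k \<in> gord_spectrum (sum_group A G)"
      using gord Sx by (force simp: gord_spectrum_def)
  qed
qed

section \<open>Affine groups over the rationals with the order k as threshold\<close>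

text \<open>
  The triple \<open>(m, z, q)\<close> acts on \<open>\<rat>\<close> as the affine map \<open>t \<mapsto> m + q t\<close>. The integer \<open>z\<close>, whose
  parity is the sign of \<open>q\<close>, is there for torsion-freeness: for \<open>k = 2\<close> the scalar \<open>-1\<close> is
  admissible, and \<open>z\<close> replaces the point reflection of order two by an element of infinite order.
\<close>

definition twisted_affine_group :: "nat \<Rightarrow> (rat \<times> int \<times> rat) monoid"
  where "twisted_affine_group k =
    \<lparr>carrier = {(m, z, q). admissible_scalar k q \<and> (0 < q \<longleftrightarrow> even z)},
     monoid.mult = (\<lambda>(m, z, q) (m', z', q'). (m + q * m', z + z', q * q')),
     one = (0, 0, 1)\<rparr>"

lemma carrier_twisted_affine_group:
  "(m, z, q) \<in> carrier (twisted_affine_group k) \<longleftrightarrow> admissible_scalar k q \<and> (0 < q \<longleftrightarrow> even z)"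
  by (simp add: twisted_affine_group_def)

lemma mult_twisted_affine_group [simp]:
  "(m, z, q) \<otimes>\<^bsub>twisted_affine_group k\<^esub> (m', z', q') = (m + q * m', z + z', q * q')"
  by (simp add: twisted_affine_group_def)

lemma one_twisted_affine_group [simp]: "\<one>\<^bsub>twisted_affine_group k\<^esub> = (0, 0, 1)"
  by (simp add: twisted_affine_group_def)

lemma inverse_in_twisted_affine_group:
  assumes "2 \<le> k" "(m, z, q) \<in> carrier (twisted_affine_group k)"
  shows "(- m / q, - z, inverse q) \<in> carrier (twisted_affine_group k)"
  using assms by (auto simp: carrier_twisted_affine_group admissible_scalar_inverse)

lemma group_twisted_affine_group:
  assumes "2 \<le> k"
  shows "group (twisted_affine_group k)"
proof (rule groupI)
  fix x y assume xy: "x \<in> carrier (twisted_affine_group k)" "y \<in> carrier (twisted_affine_group k)"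
  obtain m z q m' z' q' where eqs: "x = (m, z, q)" "y = (m', z', q')"
    by (cases x; cases y)
  have "q \<noteq> 0" "q' \<noteq> 0"
    using xy admissible_scalar_nonzero[OF assms] by (auto simp: eqs carrier_twisted_affine_group)
  then have "0 < q * q' \<longleftrightarrow> (0 < q \<longleftrightarrow> 0 < q')"
    by (metis linorder_neqE_linordered_idom mult_neg_neg mult_neg_pos mult_pos_neg mult_pos_pos order_less_asym)
  then show "x \<otimes>\<^bsub>twisted_affine_group k\<^esub> y \<in> carrier (twisted_affine_group k)"
    using xy by (simp add: eqs carrier_twisted_affine_group admissible_scalar_mult)
next
  fix x assume x: "x \<in> carrier (twisted_affine_group k)"
  obtain m z q where [simp]: "x = (m, z, q)" by (cases x)
  have "q \<noteq> 0"
    using x admissible_scalar_nonzero[OF assms] by (simp add: carrier_twisted_affine_group)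
  then show "\<exists>y\<in>carrier (twisted_affine_group k). y \<otimes>\<^bsub>twisted_affine_group k\<^esub> x = \<one>\<^bsub>twisted_affine_group k\<^esub>"
    using x inverse_in_twisted_affine_group[OF assms, of m z q]
    by (intro bexI[of _ "(- m / q, - z, inverse q)"]) (auto simp: field_simps)
next
  show "\<one>\<^bsub>twisted_affine_group k\<^esub> \<in> carrier (twisted_affine_group k)"
    by (simp add: carrier_twisted_affine_group admissible_scalar_1)
next
  fix x y z :: "rat \<times> int \<times> rat"
  show "x \<otimes>\<^bsub>twisted_affine_group k\<^esub> y \<otimes>\<^bsub>twisted_affine_group k\<^esub> z =
      x \<otimes>\<^bsub>twisted_affine_group k\<^esub> (y \<otimes>\<^bsub>twisted_affine_group k\<^esub> z)"
    by (cases x; cases y; cases z) (simp add: distrib_left mult.assoc)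
next
  fix x :: "rat \<times> int \<times> rat"
  show "\<one>\<^bsub>twisted_affine_group k\<^esub> \<otimes>\<^bsub>twisted_affine_group k\<^esub> x = x"
    by (cases x) simp
qed

lemma inv_twisted_affine_group:
  assumes "2 \<le> k" "(m, z, q) \<in> carrier (twisted_affine_group k)"
  shows "inv\<^bsub>twisted_affine_group k\<^esub> (m, z, q) = (- m / q, - z, inverse q)"
proof -
  have "q \<noteq> 0"
    using assms admissible_scalar_nonzero by (auto simp: carrier_twisted_affine_group)
  then show ?thesis
    using assms inverse_in_twisted_affine_group
    by (intro group.inv_equality[OF group_twisted_affine_group]) (auto simp: field_simps)
qed

text \<open>
  The map \<open>(m, z, q) \<mapsto> (z, q)\<close> is a homomorphism to an abelian group, so it does not see
  conjugation.
\<close>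

lemma snd_conjugate_product_twisted_affine_group:
  assumes "2 \<le> k" "set xs \<subseteq> carrier (twisted_affine_group k)"
  shows "snd (conjugate_product (twisted_affine_group k) (m, z, q) xs) =
    (int (length xs) * z, q ^ length xs)"
  using assms(2)
proof (induction xs)
  case (Cons x xs)
  obtain a w r where x: "x = (a, w, r)" by (cases x)
  with Cons.prems have r: "r \<noteq> 0" and c: "(a, w, r) \<in> carrier (twisted_affine_group k)"
    using admissible_scalar_nonzero[OF assms(1)] by (auto simp: carrier_twisted_affine_group)
  obtain b where "conjugate_product (twisted_affine_group k) (m, z, q) xs =
      (b, int (length xs) * z, q ^ length xs)"
    using Cons by (metis list.set_intros(2) prod.collapse subset_code(1))
  then show ?case
    using r by (simp add: x conjugate_by_def inv_twisted_affine_group[OF assms(1) c] algebra_simps)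
qed simp

text \<open>
  Conjugation by \<open>(a, z, q)\<close> multiplies the translation by \<open>m\<close> with \<open>q\<close>, and translations add up.
\<close>

lemma conjugate_product_translation:
  assumes "2 \<le> k" "set xs \<subseteq> carrier (twisted_affine_group k)"
  shows "conjugate_product (twisted_affine_group k) (m, 0, 1) xs =
    (m * (\<Sum>(a, z, q)\<leftarrow>xs. q), 0, 1)"
  using assms(2)
proof (induction xs)
  case (Cons x xs)
  obtain a w r where x: "x = (a, w, r)" by (cases x)
  with Cons.prems have "r \<noteq> 0" and c: "(a, w, r) \<in> carrier (twisted_affine_group k)"
    using admissible_scalar_nonzero[OF assms(1)] by (auto simp: carrier_twisted_affine_group)
  then show ?case
    using Cons by (simp add: x conjugate_by_def inv_twisted_affine_group[OF assms(1) c] algebra_simps)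
qed simp

lemma trivial_conjugate_product_translation:
  assumes k: "2 \<le> k" and m: "m \<noteq> 0"
  shows "trivial_conjugate_product (twisted_affine_group k) (m, 0, 1) n \<longleftrightarrow> k \<le> n" (is "?L \<longleftrightarrow> ?R")
proof
  assume ?L
  then obtain xs where n: "1 \<le> n" "length xs = n" and xs: "set xs \<subseteq> carrier (twisted_affine_group k)"
    and "conjugate_product (twisted_affine_group k) (m, 0, 1) xs = (0, 0, 1)"
    by (auto simp: trivial_conjugate_product_def)
  then have "(\<Sum>(a, z, q)\<leftarrow>xs. q) = 0"
    using m by (simp add: conjugate_product_translation[OF k xs])
  moreover have "\<forall>q\<in>set (map (\<lambda>(a, z, q). q) xs). admissible_scalar k q"
    using xs by (auto simp: carrier_twisted_affine_group)
  moreover have "map (\<lambda>(a, z, q). q) xs \<noteq> []"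
    using n by auto
  ultimately show ?R
    using zero_sum_length[OF k, of "map (\<lambda>(a, z, q). q) xs"] n(2) by simp
next
  assume ?R
  \<comment> \<open>Each admissible scalar is the last component of a group element: \<open>z\<close> only has to have the right parity.\<close>
  define lift :: "rat \<Rightarrow> rat \<times> int \<times> rat" where "lift q = (0, if 0 < q then 0 else 1, q)" for q
  define xs where "xs = map lift (zero_sum_list k n)"
  note zs = zero_sum_list_properties[OF k \<open>k \<le> n\<close>]
  have xs: "set xs \<subseteq> carrier (twisted_affine_group k)"
    using zs(3) by (auto simp: xs_def lift_def carrier_twisted_affine_group)
  have "map (\<lambda>(a, z, q). q) xs = zero_sum_list k n"
    by (simp add: xs_def lift_def comp_def)
  then have "conjugate_product (twisted_affine_group k) (m, 0, 1) xs = (0, 0, 1)"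
    using zs(2) by (simp add: conjugate_product_translation[OF k xs])
  moreover have "length xs = n"
    using zs(1) by (simp add: xs_def)
  ultimately show ?L
    using k \<open>k \<le> n\<close> xs by (auto simp: trivial_conjugate_product_def)
qed

text \<open>
  The image \<open>(z, q)\<close> of the element satisfies \<open>n z = 0\<close> and \<open>q\<^sup>n = 1\<close>; the first forces \<open>z = 0\<close>, and
  then \<open>q\<close> is positive, which leaves only \<open>q = 1\<close>.
\<close>

lemma trivial_conjugate_product_imp_translation:
  assumes k: "2 \<le> k" and g: "g \<in> carrier (twisted_affine_group k)"
    and n: "trivial_conjugate_product (twisted_affine_group k) g n"
  shows "\<exists>m. g = (m, 0, 1)"
proof -
  obtain m z q where g_eq: "g = (m, z, q)" by (cases g)
  from n obtain xs where "1 \<le> n" "length xs = n" and xs: "set xs \<subseteq> carrier (twisted_affine_group k)"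
    and "conjugate_product (twisted_affine_group k) g xs = (0, 0, 1)"
    by (auto simp: trivial_conjugate_product_def)
  then have "int n * z = 0" "q ^ n = 1" "1 \<le> n"
    using snd_conjugate_product_twisted_affine_group[OF k xs, of m z q] by (auto simp: g_eq)
  then have "z = 0" "q ^ n = 1" "0 < n" by auto
  moreover from this have "0 < q"
    using g by (simp add: g_eq carrier_twisted_affine_group)
  ultimately show ?thesis
    using power_eq_iff_eq_base[of n q 1] by (simp add: g_eq)
qed

lemma trivial_conjugate_product_twisted_affine_group:
  assumes "2 \<le> k" "g \<in> carrier (twisted_affine_group k)" "g \<noteq> \<one>\<^bsub>twisted_affine_group k\<^esub>"
    and "trivial_conjugate_product (twisted_affine_group k) g n\<^sub>0"
  shows "trivial_conjugate_product (twisted_affine_group k) g n \<longleftrightarrow> k \<le> n"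
  using trivial_conjugate_product_imp_translation[OF assms(1,2,4)] assms(3)
    trivial_conjugate_product_translation[OF assms(1)] by auto

lemma (in group) pow_eq_conjugate_product:
  "g \<in> carrier G \<Longrightarrow> g [^] n = conjugate_product G g (replicate n \<one>)"
proof (induction n)
  case (Suc n)
  then show ?case
    by (metis conjugate_by_def conjugate_product_Cons inv_one l_one nat_pow_Suc2 r_one replicate_Suc)
qed simp

text \<open>
  A power is a product of conjugates by the identity, so a torsion element is a translation, and
  the rationals are torsion-free.
\<close>

lemma torsion_free_twisted_affine_group:
  assumes k: "2 \<le> k"
  shows "torsion_free (twisted_affine_group k)"
  unfolding torsion_free_def
proof (intro allI impI)
  interpret group "twisted_affine_group k" using group_twisted_affine_group[OF k] .
  fix g assume "torsion_element (twisted_affine_group k) g"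
  then obtain n :: nat where g: "g \<in> carrier (twisted_affine_group k)" and n: "1 \<le> n"
    and "g [^]\<^bsub>twisted_affine_group k\<^esub> n = \<one>\<^bsub>twisted_affine_group k\<^esub>"
    by (auto simp: torsion_element_def)
  then have prod: "conjugate_product (twisted_affine_group k) g
      (replicate n \<one>\<^bsub>twisted_affine_group k\<^esub>) = (0, 0, 1)"
    by (simp only: pow_eq_conjugate_product one_twisted_affine_group)
  have ones: "set (replicate n \<one>\<^bsub>twisted_affine_group k\<^esub>) \<subseteq> carrier (twisted_affine_group k)"
    using one_closed by auto
  have "trivial_conjugate_product (twisted_affine_group k) g n"
    using prod ones n unfolding trivial_conjugate_product_def
    by (metis length_replicate one_twisted_affine_group)
  then obtain m where "g = (m, 0, 1)"
    using trivial_conjugate_product_imp_translation[OF k g] by auto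
  from prod have "m * of_nat n = 0"
    unfolding \<open>g = (m, 0, 1)\<close> conjugate_product_translation[OF k ones]
    by (simp add: sum_list_replicate)
  with n show "g = \<one>\<^bsub>twisted_affine_group k\<^esub>"
    by (simp add: \<open>g = (m, 0, 1)\<close>)
qed

theorem corollary7p5:
  fixes A :: "nat set"
  assumes "A \<subseteq> {2..}"
  shows "\<exists>G :: nat monoid. group G \<and> countable (carrier G) \<and> torsion_free G \<and>
    strict_gord_spectrum G = A \<and> gord_spectrum G = A"
proof -
  have k: "2 \<le> k" if "k \<in> A" for k
    using assms that by auto
  have G: "group (twisted_affine_group k)" if "k \<in> A" for k
    using group_twisted_affine_group k that by auto
  define S where "S = sum_group A twisted_affine_group"
  have S: "group S" "countable (carrier S)"
    using G by (auto simp: S_def intro!: countable_sum_group)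
  then obtain G :: "nat monoid" and h where iso: "group G" "h \<in> iso S G"
    using countable_group_iso_nat by blast
  have "torsion_free S"
    unfolding S_def by (rule torsion_free_sum_group[OF G torsion_free_twisted_affine_group[OF k]])
  then have tf: "torsion_free G"
    using torsion_free_iso S(1) iso by blast
  have "gord_spectrum S = A"
    unfolding S_def
  proof (rule gord_spectrum_sum_group[OF G])
    show "A \<subseteq> {1..}"
      using assms by auto
    show "trivial_conjugate_product (twisted_affine_group k) g n \<longleftrightarrow> k \<le> n"
      if "k \<in> A" "g \<in> carrier (twisted_affine_group k)" "g \<noteq> \<one>\<^bsub>twisted_affine_group k\<^esub>"
        "trivial_conjugate_product (twisted_affine_group k) g n\<^sub>0" for k g n\<^sub>0 n
      by (rule trivial_conjugate_product_twisted_affine_group[OF k[OF that(1)] that(2-4)])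
    show "\<exists>g. generalized_torsion_element (twisted_affine_group k) g" if "k \<in> A" for k
      using trivial_conjugate_product_translation[OF k[OF that], of 1]
      by (intro exI[of _ "(1, 0, 1)"])
        (auto simp: generalized_torsion_element_def carrier_twisted_affine_group admissible_scalar_1)
  qed
  then have "gord_spectrum G = A"
    using gord_spectrum_iso S(1) iso by blast
  with tf iso show ?thesis
    using strict_gord_spectrum_torsion_free by (intro exI[of _ G]) auto
qed

end
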